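(* (Limit Al-Salam–Carlitz I case.) Let $0<|q|<1$ and let $\delta$ be a nonzero complex number. Then for $z\neq0$ for which the right-hand side is defined, $$\cfrac{1}{z-(1+\delta^{-1})-\cfrac{q/\delta}{z-(1+\delta^{-1})q-\cfrac{q^3/\delta}{z-(1+\delta^{-1})q^2-\cdots}}}=\frac{1}{z\left(1-\frac{1}{\delta z}\right)}\;\frac{{}_1\phi_1\left(\begin{matrix}0\\ q/(z\delta)\end{matrix};\frac qz\right)}{{}_1\phi_1\left(\begin{matrix}0\\ 1/(z\delta)\end{matrix};\frac1z\right)},$$ where the $n$-th partial numerator ($n\ge1$) subtracted is $q^{2n-1}/\delta$ and the partial denominators are $z-(1+\delta^{-1})q^n$ ($n\ge0$).
   Context: Notation: $(a)_k=\prod_{j=0}^{k-1}(1-aq^j)$ and ${}_1\phi_1\left(\begin{matrix}a\\ c\end{matrix};w\right)=\sum_{k\ge0}\frac{(a)_k}{(c)_k(q)_k}(-1)^kq^{k(k-1)/2}w^k$. "Defined" means that no lower parameter is of the form $q^{-k}$ ($k\ge0$) and the denominator does not vanish. *)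

theory Defs
  imports Complex_Main
begin

definition qpoch :: "complex \<Rightarrow> complex \<Rightarrow> nat \<Rightarrow> complex" where
  "qpoch a q k = (\<Prod>j<k. 1 - a * q ^ j)"

definition phi11 :: "complex \<Rightarrow> complex \<Rightarrow> complex \<Rightarrow> complex \<Rightarrow> complex" where
  "phi11 q a c w =
     (\<Sum>k. qpoch a q k / (qpoch c q k * qpoch q q k) * (- 1) ^ k * q ^ (k * (k - 1) div 2) * w ^ k)"

definition lower_param_ok :: "complex \<Rightarrow> complex \<Rightarrow> bool" where
  "lower_param_ok q c \<longleftrightarrow> (\<forall>k::nat. c \<noteq> 1 / q ^ k)"

text \<open>
  Canonical numerators and denominators of the continued fraction
  \<open>a 0 / (b 0 + a 1 / (b 1 + a 2 / (b 2 + \<dots>)))\<close>; index \<open>n\<close> stands for the truncation that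
  uses the first \<open>n\<close> pairs \<open>(a k, b k)\<close>.
\<close>

fun cf_num :: "(nat \<Rightarrow> complex) \<Rightarrow> (nat \<Rightarrow> complex) \<Rightarrow> nat \<Rightarrow> complex" where
  "cf_num a b 0 = 0"
| "cf_num a b (Suc 0) = a 0"
| "cf_num a b (Suc (Suc n)) = b (Suc n) * cf_num a b (Suc n) + a (Suc n) * cf_num a b n"

fun cf_den :: "(nat \<Rightarrow> complex) \<Rightarrow> (nat \<Rightarrow> complex) \<Rightarrow> nat \<Rightarrow> complex" where
  "cf_den a b 0 = 1"
| "cf_den a b (Suc 0) = b 0"
| "cf_den a b (Suc (Suc n)) = b (Suc n) * cf_den a b (Suc n) + a (Suc n) * cf_den a b n"

text \<open>
  The continued fraction converges to a finite value if its approximants do. Approximants are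
  taken as quotients of canonical numerators and denominators, since a vanishing inner denominator
  means an intermediate value at infinity, not \<open>x / 0 = 0\<close>. Finitely many approximants may
  be infinite.
\<close>

definition cf_converges_to ::
    "(nat \<Rightarrow> complex) \<Rightarrow> (nat \<Rightarrow> complex) \<Rightarrow> complex \<Rightarrow> bool" where
  "cf_converges_to a b L \<longleftrightarrow>
     (\<forall>\<^sub>F n in sequentially. cf_den a b n \<noteq> 0) \<and>
     (\<lambda>n. cf_num a b n / cf_den a b n) \<longlonglongrightarrow> L"

text \<open>
  When no inner denominator vanishes, the approximant is the nested finite fraction; here
  \<open>w k\<close> is its tail starting at \<open>a k\<close>.
\<close>

lemma nested_fraction_eq_approximant:
  assumes tail: "\<And>k. k \<le> n \<Longrightarrow> w k = a k / (b k + w (Suc k))"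
    and nz: "\<And>k. k \<le> n \<Longrightarrow> b k + w (Suc k) \<noteq> 0"
    and last: "w (Suc n) = 0"
  shows "cf_den a b (Suc n) \<noteq> 0"
    and "w 0 = cf_num a b (Suc n) / cf_den a b (Suc n)"
proof -
  have "cf_den a b (Suc k) + cf_den a b k * w (Suc k) \<noteq> 0 \<and>
        w 0 * (cf_den a b (Suc k) + cf_den a b k * w (Suc k)) =
        cf_num a b (Suc k) + cf_num a b k * w (Suc k)" if "k \<le> n" for k
    using that
  proof (induction k)
    case 0
    then show ?case using tail[of 0] nz[of 0] by simp
  next
    case (Suc k)
    let ?d = "b (Suc k) + w (Suc (Suc k))"
    have a: "a (Suc k) = w (Suc k) * ?d" and d: "?d \<noteq> 0"
      using tail[OF Suc.prems] nz[OF Suc.prems] by auto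
    have B: "cf_den a b (Suc (Suc k)) + cf_den a b (Suc k) * w (Suc (Suc k)) =
             ?d * (cf_den a b (Suc k) + cf_den a b k * w (Suc k))"
      by (simp add: a algebra_simps)
    have A: "cf_num a b (Suc (Suc k)) + cf_num a b (Suc k) * w (Suc (Suc k)) =
             ?d * (cf_num a b (Suc k) + cf_num a b k * w (Suc k))"
      by (simp add: a algebra_simps)
    show ?case
      unfolding A B using Suc.IH Suc.prems d by (auto simp: mult.left_commute)
  qed
  from this[of n] last show "cf_den a b (Suc n) \<noteq> 0"
    and "w 0 = cf_num a b (Suc n) / cf_den a b (Suc n)"
    by (auto simp: field_simps)
qed

end

(* Write u = 1/(z\<delta>), v = 1/z and G n = 1phi1(0; u q^n; v q^n). A three-term contiguous relation for
   1phi1 makes, for every solution y of the recurrence of the continued fraction, a combination of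
   x (n+1) and x n constant in n, where x n = y n / (z^n (u)_n). Its coefficients tend to 1 and 0
   because G n tends to 1, so x n converges to that constant; the constants for the canonical
   denominators and numerators are G 0 and G 1 / (z (1 - u)). *)
theory Submission
  imports Defs
begin

section \<open>Terms of the series and their summability\<close>

text \<open>The summand for upper parameter 0, where \<open>(0)_k = 1\<close>.\<close>

definition phi11_term :: "complex \<Rightarrow> complex \<Rightarrow> complex \<Rightarrow> nat \<Rightarrow> complex" where
  "phi11_term q c w k =
     (- 1) ^ k * q ^ (k * (k - 1) div 2) * w ^ k / (qpoch c q k * qpoch q q k)"

lemma qpoch_0_left [simp]: "qpoch 0 q k = 1"
  by (simp add: qpoch_def)

lemma qpoch_0 [simp]: "qpoch c q 0 = 1"
  by (simp add: qpoch_def)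

lemma qpoch_Suc: "qpoch c q (Suc k) = qpoch c q k * (1 - c * q ^ k)"
  by (simp add: qpoch_def)

text \<open>Splitting off the first factor instead of the last links the parameters \<open>c\<close>
  and \<open>c * q\<close>.\<close>

lemma qpoch_Suc_shift: "qpoch c q (Suc k) = (1 - c) * qpoch (c * q) q k"
  unfolding qpoch_def by (subst prod.lessThan_Suc_shift) (simp add: mult.assoc)

lemma qpoch_nonzero: "(\<And>k. c * q ^ k \<noteq> 1) \<Longrightarrow> qpoch c q n \<noteq> 0"
  by (auto simp: qpoch_def)

lemma phi11_eq_suminf: "phi11 q 0 c w = (\<Sum>k. phi11_term q c w k)"
  by (simp add: phi11_def phi11_term_def)

lemma mult_power_neq_one:
  fixes q :: complex
  assumes "norm q < 1"
  shows "q * q ^ k \<noteq> 1"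
proof
  assume "q * q ^ k = 1"
  then have "norm q ^ Suc k = 1"
    by (metis norm_one norm_power power_Suc)
  moreover have "norm q ^ Suc k < 1"
    using assms by (simp add: power_Suc_less_one power_less_one_iff del: power_Suc)
  ultimately show False by simp
qed

lemma triangle_Suc: "Suc k * (Suc k - 1) div 2 = k * (k - 1) div 2 + k"
proof -
  have "Suc k * (Suc k - 1) = k * (k - 1) + k * 2"
    by (cases k) auto
  then show ?thesis by simp
qed

lemma phi11_term_0 [simp]: "phi11_term q c w 0 = 1"
  by (simp add: phi11_term_def)

text \<open>Valid for every \<open>c\<close>: where a denominator factor vanishes, division by zero
  turns both sides into 0.\<close>

lemma phi11_term_Suc:
  "phi11_term q c w (Suc k) =
     phi11_term q c w k * (- (w * q ^ k) / ((1 - c * q ^ k) * (1 - q * q ^ k)))"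
  unfolding phi11_term_def triangle_Suc qpoch_Suc
  by (simp add: power_add ac_simps)

text \<open>The ratio of consecutive terms carries a factor \<open>q ^ k\<close>, while its
  denominator tends to 1; so it tends to 0 and the ratio test applies.\<close>

lemma summable_phi11_term:
  assumes q: "norm q < 1"
  shows "summable (phi11_term q c w)"
proof -
  have q0: "(\<lambda>k. q ^ k) \<longlonglongrightarrow> 0"
    using q by (rule LIMSEQ_power_zero)
  have "(\<lambda>k. norm (- (w * q ^ k) / ((1 - c * q ^ k) * (1 - q * q ^ k)))) \<longlonglongrightarrow>
        norm (- (w * 0) / ((1 - c * 0) * (1 - q * 0)))"
    by (intro tendsto_intros q0) auto
  then have "(\<lambda>k. norm (- (w * q ^ k) / ((1 - c * q ^ k) * (1 - q * q ^ k)))) \<longlonglongrightarrow> 0"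
    by simp
  then have "\<forall>\<^sub>F k in sequentially. norm (- (w * q ^ k) / ((1 - c * q ^ k) * (1 - q * q ^ k))) < 1/2"
    by (rule order_tendstoD(2)) simp
  then obtain N where N: "\<And>k. k \<ge> N \<Longrightarrow>
      norm (- (w * q ^ k) / ((1 - c * q ^ k) * (1 - q * q ^ k))) < 1/2"
    unfolding eventually_sequentially by blast
  show ?thesis
  proof (rule summable_ratio_test[of "1/2" N])
    fix k assume "N \<le> k"
    then show "norm (phi11_term q c w (Suc k)) \<le> 1/2 * norm (phi11_term q c w k)"
      unfolding phi11_term_Suc norm_mult
      using mult_left_mono[OF less_imp_le[OF N[of k]], of "norm (phi11_term q c w k)"]
      by (simp add: mult.commute)
  qed simp
qed

section \<open>The contiguous relation\<close>

text \<open>The relation holds coefficientwise after a shift: terms of index k+1 of the first two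
  series balance terms of index k of the series multiplied by \<open>w\<close>. The constant terms
  contribute \<open>1 - c\<close> on both sides.\<close>

lemma phi11_contiguous:
  assumes q: "norm q < 1" and c: "\<And>k. c * q ^ k \<noteq> 1"
  shows "(1 - c) * phi11 q 0 c w =
    (1 - c - w) * phi11 q 0 (c * q) (w * q) -
    c * w * q / (1 - c * q) * phi11 q 0 (c * q * q) (w * q * q)"
proof -
  let ?a = "phi11_term q c w"
  let ?b = "phi11_term q (c * q) (w * q)"
  let ?d = "phi11_term q (c * q * q) (w * q * q)"
  have coeff: "(1 - c) * ?a (Suc k) =
      (1 - c) * ?b (Suc k) - w * ?b k - c * w * q / (1 - c * q) * ?d k" for k
  proof -
    \<comment> \<open>\<open>s\<close> collects what does not depend on \<open>c\<close>; replacing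
      \<open>w\<close> by \<open>w * q\<close> multiplies it by \<open>x\<close>. All three
      Pochhammer symbols are expressed through \<open>P\<close>, so that
      \<open>P * (1 - c * q * x)\<close> is a common denominator.\<close>
    define s where "s = (\<lambda>k. (- 1) ^ k * q ^ (k * (k - 1) div 2) * w ^ k / qpoch q q k)"
    define x where "x = q ^ k"
    define P where "P = qpoch (c * q) q k"
    have "1 - q * x \<noteq> 0"
      using mult_power_neq_one[OF q, of k] by (simp add: x_def)
    then have s: "s (Suc k) * (1 - q * x) = - (x * w * s k)"
      unfolding s_def triangle_Suc qpoch_Suc x_def by (simp add: power_add)
    have c0: "1 - c \<noteq> 0" and c1: "1 - c * q \<noteq> 0" and ck: "1 - c * q * x \<noteq> 0"
      using c[of 0] c[of 1] c[of "Suc k"] by (auto simp: x_def mult.assoc)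
    have P0: "P \<noteq> 0"
      unfolding P_def using c[of "Suc _"] by (intro qpoch_nonzero) (simp add: mult.assoc)
    have "(1 - c * q) * qpoch (c * q * q) q k = P * (1 - c * q * x)"
      unfolding P_def x_def by (metis qpoch_Suc qpoch_Suc_shift)
    then have Q: "qpoch (c * q * q) q k = P * (1 - c * q * x) / (1 - c * q)"
      using c1 by (simp add: field_simps)
    have "?a (Suc k) = s (Suc k) / ((1 - c) * P)"
      by (simp add: phi11_term_def s_def P_def qpoch_Suc_shift[of c])
    moreover have "?b (Suc k) = s (Suc k) * (q * x) / (P * (1 - c * q * x))"
      by (simp add: phi11_term_def s_def P_def x_def qpoch_Suc[of "c * q"] power_mult_distrib ac_simps)
    moreover have "?b k = s k * x / P"
      by (simp add: phi11_term_def s_def P_def x_def power_mult_distrib ac_simps)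
    moreover have "?d k = s k * (x * x) / qpoch (c * q * q) q k"
      by (simp add: phi11_term_def s_def x_def power_mult_distrib ac_simps)
    then have "?d k = s k * (x * x) * (1 - c * q) / (P * (1 - c * q * x))"
      by (simp add: Q)
    moreover have "c * w * q / (1 - c * q) * (s k * (x * x) * (1 - c * q) / (P * (1 - c * q * x))) =
        c * w * q * s k * x * x / (P * (1 - c * q * x))"
      using c1 by simp
    moreover have "(1 - c) * (s (Suc k) / ((1 - c) * P)) = s (Suc k) / P"
      using c0 by simp
    moreover have "s (Suc k) / P =
        (1 - c) * (s (Suc k) * (q * x) / (P * (1 - c * q * x))) - w * (s k * x / P) -
        c * w * q * s k * x * x / (P * (1 - c * q * x))"
    proof -
      \<comment> \<open>Collecting the multiples of \<open>s (Suc k)\<close> on the left leaves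
        \<open>s (Suc k) * (1 - q * x)\<close>, and the right collapses to
        \<open>- (x * w * s k)\<close>: this is the fact \<open>s\<close>.\<close>
      have "s (Suc k) * (1 - c * q * x) =
          (1 - c) * s (Suc k) * (q * x) - w * s k * x * (1 - c * q * x) - c * w * q * s k * x * x"
        using s by algebra
      then have "s (Suc k) / P = ((1 - c) * s (Suc k) * (q * x) - w * s k * x * (1 - c * q * x) -
          c * w * q * s k * x * x) / (P * (1 - c * q * x))"
        using ck P0 by (simp add: frac_eq_eq)
      then show ?thesis
        using ck by (simp add: diff_divide_distrib mult.assoc)
    qed
    ultimately show ?thesis using c0 c1 by simp
  qed
  note sm = summable_phi11_term[OF q]
  \<comment> \<open>The leading term 1 is removed because \<open>coeff\<close> describes only the
    indices \<open>Suc k\<close>.\<close>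
  have "(1 - c) * (phi11 q 0 c w - 1) = (\<Sum>k. (1 - c) * ?a (Suc k))"
    unfolding phi11_eq_suminf using suminf_split_head[OF sm, of c w]
    by (simp add: suminf_mult summable_Suc_iff sm)
  also have "\<dots> = (\<Sum>k. (1 - c) * ?b (Suc k) - w * ?b k - c * w * q / (1 - c * q) * ?d k)"
    by (simp only: coeff)
  also have "\<dots> = (1 - c) * (\<Sum>k. ?b (Suc k)) - w * (\<Sum>k. ?b k) - c * w * q / (1 - c * q) * (\<Sum>k. ?d k)"
  proof -
    have "summable (\<lambda>k. ?b (Suc k))"
      by (simp add: summable_Suc_iff sm)
    then show ?thesis
      by (intro sums_unique[symmetric] sums_diff sums_mult summable_sums sm)
  qed
  also have "\<dots> = (1 - c) * (phi11 q 0 (c * q) (w * q) - 1) - w * phi11 q 0 (c * q) (w * q) -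
      c * w * q / (1 - c * q) * phi11 q 0 (c * q * q) (w * q * q)"
    unfolding phi11_eq_suminf using suminf_split_head[OF sm, of "c * q" "w * q"] by simp
  finally show ?thesis by (simp add: algebra_simps)
qed

section \<open>The limit of the shifted series\<close>

text \<open>For such \<open>c\<close> the denominator factors have norm at least 1/2 and
  \<open>1 - norm q\<close>, so every term ratio is at most \<open>?r\<close> and the tail is
  dominated by a geometric series. As \<open>?r\<close> is at most 1/2, the factor
  \<open>1 / (1 - ?r)\<close> is at most 2.\<close>

lemma norm_phi11_minus_one_le:
  assumes q: "norm q < 1" and c: "norm c \<le> 1/2"
    and r: "2 * norm w / (1 - norm q) \<le> 1/2" (is "?r \<le> _")
  shows "norm (phi11 q 0 c w - 1) \<le> 2 * ?r"
proof -
  have r0: "0 \<le> ?r" using q by simp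
  have "norm (phi11_term q c w k) \<le> ?r ^ k" for k
  proof (induction k)
    case (Suc k)
    have qk: "norm q ^ k \<le> 1" using q by (simp add: power_le_one)
    have "norm (c * q ^ k) \<le> 1/2 * 1"
      unfolding norm_mult norm_power using c qk by (intro mult_mono) auto
    then have 1: "1/2 \<le> norm (1 - c * q ^ k)"
      using norm_triangle_ineq2[of 1 "c * q ^ k"] by simp
    have "norm (q * q ^ k) \<le> norm q * 1"
      unfolding norm_mult norm_power using qk by (intro mult_left_mono) auto
    then have 2: "1 - norm q \<le> norm (1 - q * q ^ k)"
      using norm_triangle_ineq2[of 1 "q * q ^ k"] by simp
    have "norm w * norm q ^ k \<le> norm w * 1"
      using qk by (intro mult_left_mono) auto
    then have "norm w * norm q ^ k / (norm (1 - c * q ^ k) * norm (1 - q * q ^ k))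
        \<le> norm w / (1/2 * (1 - norm q))"
      using 1 2 q by (intro frac_le mult_mono mult_pos_pos) auto
    then have "norm (- (w * q ^ k) / ((1 - c * q ^ k) * (1 - q * q ^ k))) \<le> ?r"
      by (simp add: norm_mult norm_divide norm_power mult.commute)
    then show ?case
      unfolding phi11_term_Suc norm_mult power_Suc2
      using Suc.IH r0 by (intro mult_mono) auto
  qed simp
  then have bd: "norm (phi11_term q c w (Suc k)) \<le> ?r * ?r ^ k" for k
    by (metis power_Suc)
  have geo: "(\<lambda>k. ?r * ?r ^ k) sums (?r * (1 / (1 - ?r)))"
    using r r0 by (intro sums_mult geometric_sums) (simp only: real_norm_def abs_of_nonneg)
  have "phi11 q 0 c w - 1 = (\<Sum>k. phi11_term q c w (Suc k))"
    unfolding phi11_eq_suminf using suminf_split_head[OF summable_phi11_term[OF q], of c w] by simp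
  also have "norm \<dots> \<le> (\<Sum>k. ?r * ?r ^ k)"
    by (rule norm_suminf_le[OF bd sums_summable[OF geo]])
  also have "\<dots> = ?r * (1 / (1 - ?r))"
    using geo by (rule sums_unique[symmetric])
  also have "\<dots> \<le> ?r * 2"
    using r r0 by (intro mult_left_mono) (auto simp: pos_divide_le_eq)
  finally show ?thesis by simp
qed

text \<open>Parameter and argument both shrink like \<open>q ^ n\<close>, so the preceding estimate
  applies eventually, with a bound that tends to 0.\<close>

lemma phi11_shift_tendsto_one:
  assumes q: "norm q < 1"
  shows "(\<lambda>n. phi11 q 0 (c * q ^ n) (w * q ^ n)) \<longlonglongrightarrow> 1"
proof -
  let ?r = "\<lambda>n. 2 * norm (w * q ^ n) / (1 - norm q)"
  have q0: "(\<lambda>k. q ^ k) \<longlonglongrightarrow> 0"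
    using q by (rule LIMSEQ_power_zero)
  have "?r \<longlonglongrightarrow> 2 * norm (w * 0) / (1 - norm q)"
    using q by (intro tendsto_intros q0) auto
  then have r: "?r \<longlonglongrightarrow> 0" by simp
  have "(\<lambda>n. norm (c * q ^ n)) \<longlonglongrightarrow> norm (c * 0)"
    by (intro tendsto_intros q0)
  then have "\<forall>\<^sub>F n in sequentially. norm (c * q ^ n) < 1/2"
    by (rule order_tendstoD(2)) simp
  moreover have "\<forall>\<^sub>F n in sequentially. ?r n < 1/2"
    using r by (rule order_tendstoD(2)) simp
  ultimately have "\<forall>\<^sub>F n in sequentially.
      norm (phi11 q 0 (c * q ^ n) (w * q ^ n) - 1) \<le> norm (?r n) * 2"
  proof eventually_elim
    case (elim n)
    then have "norm (phi11 q 0 (c * q ^ n) (w * q ^ n) - 1) \<le> 2 * ?r n"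
      by (intro norm_phi11_minus_one_le q) auto
    also have "\<dots> \<le> norm (?r n) * 2"
      by (simp only: real_norm_def)
    finally show ?case .
  qed
  with r have "(\<lambda>n. phi11 q 0 (c * q ^ n) (w * q ^ n) - 1) \<longlonglongrightarrow> 0"
    by (rule tendsto_0_le)
  then show ?thesis by (simp add: LIM_zero_iff)
qed

section \<open>Asymptotics of solutions of the recurrence\<close>

text \<open>Once \<beta> is small, the sequence stays bounded; then \<open>\<beta> n * x n\<close>
  tends to 0 and \<open>x (Suc n)\<close> inherits the limit of \<alpha>.\<close>

lemma first_order_recurrence_tendsto:
  fixes x \<alpha> \<beta> :: "nat \<Rightarrow> complex"
  assumes rec: "\<forall>\<^sub>F n in sequentially. x (Suc n) = \<alpha> n + \<beta> n * x n"
    and \<alpha>: "\<alpha> \<longlonglongrightarrow> l" and \<beta>: "\<beta> \<longlonglongrightarrow> 0"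
  shows "x \<longlonglongrightarrow> l"
proof -
  obtain A where A: "\<And>n. norm (\<alpha> n) \<le> A"
    using convergent_imp_Bseq[OF convergentI[OF \<alpha>]] unfolding Bseq_def by blast
  have "\<forall>\<^sub>F n in sequentially. norm (\<beta> n) < 1/2"
    using tendsto_norm[OF \<beta>] by (intro order_tendstoD(2)[of _ "norm (0::complex)"]) auto
  with rec obtain N where
    N: "\<And>n. n \<ge> N \<Longrightarrow> x (Suc n) = \<alpha> n + \<beta> n * x n \<and> norm (\<beta> n) < 1/2"
    unfolding eventually_sequentially by (metis (full_types) le_cases order_trans)
  \<comment> \<open>The first entry starts the induction at \<open>N\<close>; the second gives
    \<open>A + 1/2 * B \<le> B\<close>, which carries it on.\<close>
  define B where "B = max (norm (x N)) (2 * A)"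
  have bd: "norm (x n) \<le> B" if "n \<ge> N" for n
    using that
  proof (induction n rule: dec_induct)
    case base
    then show ?case by (simp add: B_def)
  next
    case (step n)
    have "norm (x (Suc n)) \<le> norm (\<alpha> n) + norm (\<beta> n) * norm (x n)"
      using N[OF step.hyps(1)] norm_triangle_ineq[of "\<alpha> n" "\<beta> n * x n"] by (simp add: norm_mult)
    also have "\<dots> \<le> A + 1/2 * B"
      using N[OF step.hyps(1)] A step.IH by (intro add_mono mult_mono) auto
    also have "\<dots> \<le> B" by (simp add: B_def)
    finally show ?case .
  qed
  have "(\<lambda>n. \<beta> n * x n) \<longlonglongrightarrow> 0"
    using bd by (intro tendsto_0_le[OF \<beta>, of _ B])
      (auto simp: eventually_sequentially norm_mult intro!: exI[of _ N] mult_left_mono)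
  from tendsto_add[OF \<alpha> this] have "(\<lambda>n. \<alpha> n + \<beta> n * x n) \<longlonglongrightarrow> l" by simp
  then have "(\<lambda>n. x (Suc n)) \<longlonglongrightarrow> l"
    by (rule Lim_transform_eventually) (use rec in \<open>auto elim: eventually_mono\<close>)
  then show ?thesis by (simp add: filterlim_sequentially_Suc)
qed

text \<open>\<open>y\<close> is an arbitrary solution, so that one limit serves both the canonical
  denominators and the canonical numerators. After normalization \<open>x\<close> and
  \<open>G\<close> satisfy mutually adjoint recurrences, one running forward and one backward, which
  yields the conserved combination.\<close>

lemma recurrence_solution_tendsto:
  fixes q u v z :: complex and y :: "nat \<Rightarrow> complex"
  defines "G \<equiv> \<lambda>n. phi11 q 0 (u * q ^ n) (v * q ^ n)"
  assumes q: "norm q < 1" and u: "\<And>k. u * q ^ k \<noteq> 1" and z: "z \<noteq> 0"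
    and y: "\<And>n. y (Suc (Suc n)) =
      z * (1 - (u + v) * q ^ Suc n) * y (Suc n) - z\<^sup>2 * u * v * q ^ (2 * n + 1) * y n"
  shows "(\<lambda>n. y n / (z ^ n * qpoch u q n)) \<longlonglongrightarrow>
    (y 1 * G 1 / z - u * v * q / (1 - u * q) * G 2 * y 0) / (1 - u)"
proof -
  define x where "x = (\<lambda>n. y n / (z ^ n * qpoch u q n))"
  \<comment> \<open>\<gamma> is the last coefficient in both normalized recurrences:
    \<open>\<gamma> n\<close> multiplies \<open>x n\<close> in the one for
    \<open>x (Suc (Suc n))\<close>, and \<open>G (Suc (Suc n))\<close> in the one for
    \<open>G n\<close>. \<open>L\<close> is the conserved value read off at n = 0.\<close>
  define \<gamma> where "\<gamma> = (\<lambda>n. u * v * q ^ (2 * n + 1) / ((1 - u * q ^ n) * (1 - u * q ^ Suc n)))"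
  define L where "L = (y 1 * G 1 / z - u * v * q / (1 - u * q) * G 2 * y 0) / (1 - u)"
  have G: "(1 - u * q ^ n) * G n = (1 - u * q ^ n - v * q ^ n) * G (Suc n) -
      u * v * q ^ (2 * n + 1) / (1 - u * q ^ Suc n) * G (Suc (Suc n))" for n
  proof -
    have "(u * q ^ n) * q ^ k \<noteq> 1" for k
      using u[of "n + k"] by (simp add: power_add mult.assoc)
    from phi11_contiguous[OF q this, of "v * q ^ n"] show ?thesis
      unfolding G_def by (simp add: power_add power_mult power2_eq_square ac_simps)
  qed
  have inv: "G (Suc n) * x (Suc n) - \<gamma> n * G (Suc (Suc n)) * x n = L" for n
  proof (induction n)
    case 0
    show ?case
      using u[of 0] u[of 1] z
      by (simp add: x_def \<gamma>_def L_def qpoch_Suc diff_divide_distrib numeral_2_eq_2 ac_simps)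
  next
    case (Suc n)
    define p where "p = qpoch u q n"
    define s where "s = q ^ n"
    have nz: "1 - u * s \<noteq> 0" "1 - u * (q * s) \<noteq> 0" "1 - u * (q * (q * s)) \<noteq> 0" "z ^ n \<noteq> 0" "p \<noteq> 0"
      using u[of n] u[of "Suc n"] u[of "Suc (Suc n)"] z qpoch_nonzero[of u q n] u
      by (auto simp: s_def p_def)
    have x0: "y n = z ^ n * p * x n"
      and x1: "y (Suc n) = z * z ^ n * p * (1 - u * s) * x (Suc n)"
      and x2: "y (Suc (Suc n)) = z * z * z ^ n * p * (1 - u * s) * (1 - u * (q * s)) * x (Suc (Suc n))"
      using nz z by (simp_all add: x_def qpoch_Suc s_def[symmetric] p_def[symmetric])
    \<comment> \<open>Expressing the three values of \<open>y\<close> through \<open>x\<close>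
      brings out a nonzero common factor, cancelled in \<open>X\<close>.\<close>
    have "z * z * z ^ n * p * ((1 - u * s) * (1 - u * (q * s)) * x (Suc (Suc n))) =
        z * z * z ^ n * p * ((1 - (u + v) * (q * s)) * (1 - u * s) * x (Suc n) - u * v * q * s\<^sup>2 * x n)"
      using y[of n] unfolding x0 x1 x2
      by (simp add: s_def power_add power_mult power2_eq_square mult.commute[of 2] power_mult_distrib algebra_simps)
    then have X: "(1 - u * s) * (1 - u * (q * s)) * x (Suc (Suc n)) =
        (1 - (u + v) * (q * s)) * (1 - u * s) * x (Suc n) - u * v * q * s\<^sup>2 * x n"
      using nz z by simp
    have g0: "\<gamma> n = u * v * q * s\<^sup>2 / ((1 - u * s) * (1 - u * (q * s)))"
      and g1: "\<gamma> (Suc n) = u * v * q * (q * s)\<^sup>2 / ((1 - u * (q * s)) * (1 - u * (q * (q * s))))"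
      by (simp_all add: \<gamma>_def s_def power_mult power2_eq_square power_mult_distrib mult.commute[of 2] ac_simps)
    have H: "(1 - u * (q * s)) * G (Suc n) = (1 - u * (q * s) - v * (q * s)) * G (Suc (Suc n)) -
      u * v * q * (q * s)\<^sup>2 / (1 - u * (q * (q * s))) * G (Suc (Suc (Suc n)))"
      using G[of "Suc n"]
      by (simp add: s_def power_mult power2_eq_square power_mult_distrib mult.commute[of 2] ac_simps)
    have "x (Suc (Suc n)) = ((1 - (u + v) * (q * s)) * (1 - u * s) * x (Suc n) - u * v * q * s\<^sup>2 * x n)
        / ((1 - u * s) * (1 - u * (q * s)))"
      using X nz by (simp add: eq_divide_eq mult.commute)
    also have "\<dots> = (1 - (u + v) * (q * s)) / (1 - u * (q * s)) * x (Suc n) - \<gamma> n * x n"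
      unfolding g0 using nz by (subst diff_divide_distrib) simp
    finally have X': "x (Suc (Suc n)) =
      (1 - (u + v) * (q * s)) / (1 - u * (q * s)) * x (Suc n) - \<gamma> n * x n" .
    have divide_through: "a = k / d * b - m / (d * e) * c"
      if "d * a = k * b - m / e * c" "d \<noteq> 0" for a b c d e k m :: complex
    proof -
      have "a = (k * b - m / e * c) / d"
        using that by (simp add: eq_divide_eq mult.commute)
      then show ?thesis by (simp add: diff_divide_distrib mult.commute)
    qed
    have "1 - u * (q * s) - v * (q * s) = 1 - (u + v) * (q * s)"
      by (simp add: algebra_simps)
    \<comment> \<open>Division by \<open>1 - u * (q * s)\<close> gives
      \<open>G (Suc (Suc n))\<close> the same coefficient that \<open>x (Suc n)\<close> has in
      \<open>X'\<close>.\<close>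
    from divide_through[OF H[unfolded this] nz(2)]
    have H': "G (Suc n) = (1 - (u + v) * (q * s)) / (1 - u * (q * s)) * G (Suc (Suc n)) -
        \<gamma> (Suc n) * G (Suc (Suc (Suc n)))"
      unfolding g1 .
    define K where "K = (1 - (u + v) * (q * s)) / (1 - u * (q * s))"
    \<comment> \<open>With \<open>x (Suc (Suc n))\<close> eliminated on the left and
      \<open>G (Suc n)\<close> on the right, both sides are the same polynomial.\<close>
    show ?case
      unfolding Suc.IH[symmetric] X'[folded K_def] H'[folded K_def] by (simp add: algebra_simps)
  qed
  have G1: "G \<longlonglongrightarrow> 1"
    unfolding G_def by (rule phi11_shift_tendsto_one[OF q])
  note G2 = LIMSEQ_Suc[OF G1] and G3 = LIMSEQ_Suc[OF LIMSEQ_Suc[OF G1]]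
  have q0: "(\<lambda>k. q ^ k) \<longlonglongrightarrow> 0"
    using q by (rule LIMSEQ_power_zero)
  have "\<gamma> = (\<lambda>n. u * v * (q * (q ^ n * q ^ n)) / ((1 - u * q ^ n) * (1 - u * q ^ Suc n)))"
    by (simp add: \<gamma>_def power_add mult_2 mult_2_right ac_simps)
  also have "\<dots> \<longlonglongrightarrow> u * v * (q * (0 * 0)) / ((1 - u * 0) * (1 - u * 0))"
    by (intro tendsto_intros q0 LIMSEQ_Suc[OF q0]) auto
  finally have \<gamma>: "\<gamma> \<longlonglongrightarrow> 0" by simp
  \<comment> \<open>Since \<open>G\<close> tends to 1, \<open>inv\<close> can eventually be solved
    for \<open>x (Suc n)\<close>, a recurrence of first order.\<close>
  have "\<forall>\<^sub>F n in sequentially. G (Suc n) \<noteq> 0"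
    using G2 by (rule tendsto_imp_eventually_ne) simp
  then have "\<forall>\<^sub>F n in sequentially.
      x (Suc n) = L / G (Suc n) + \<gamma> n * G (Suc (Suc n)) / G (Suc n) * x n"
    by eventually_elim (use inv in \<open>simp add: field_simps\<close>)
  moreover have "(\<lambda>n. L / G (Suc n)) \<longlonglongrightarrow> L"
    using tendsto_divide[OF tendsto_const G2, of L] by simp
  moreover have "(\<lambda>n. \<gamma> n * G (Suc (Suc n)) / G (Suc n)) \<longlonglongrightarrow> 0"
    using tendsto_divide[OF tendsto_mult[OF \<gamma> G3] G2] by simp
  ultimately have "x \<longlonglongrightarrow> L"
    by (rule first_order_recurrence_tendsto)
  then show ?thesis by (simp add: x_def L_def)
qed

section \<open>Convergence of the continued fraction\<close>

theorem mainTheorem13: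
  fixes q \<delta> z :: complex
  assumes "0 < norm q" and "norm q < 1"
    and "\<delta> \<noteq> 0" and "z \<noteq> 0"
    and "lower_param_ok q (q / (z * \<delta>))"
    and "lower_param_ok q (1 / (z * \<delta>))"
    and "z * (1 - 1 / (\<delta> * z)) * phi11 q 0 (1 / (z * \<delta>)) (1 / z) \<noteq> 0"
  shows "cf_converges_to
           (\<lambda>n. if n = 0 then 1 else - (q ^ (2 * n - 1) / \<delta>))
           (\<lambda>n. z - (1 + 1 / \<delta>) * q ^ n)
           (1 / (z * (1 - 1 / (\<delta> * z))) *
              (phi11 q 0 (q / (z * \<delta>)) (q / z) / phi11 q 0 (1 / (z * \<delta>)) (1 / z)))"
proof -
  define u where "u = 1 / (z * \<delta>)"
  define v where "v = 1 / z"
  define a where "a = (\<lambda>n. if n = 0 then 1 else - (q ^ (2 * n - 1) / \<delta>))"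
  define b where "b = (\<lambda>n. z - (1 + 1 / \<delta>) * q ^ n)"
  define G where "G = (\<lambda>n. phi11 q 0 (u * q ^ n) (v * q ^ n))"
  have u: "u * q ^ k \<noteq> 1" for k
    using assms(1,6) by (auto simp: lower_param_ok_def u_def eq_divide_eq)
  have u0: "1 - u \<noteq> 0" using u[of 0] by simp
  have G0: "G 0 \<noteq> 0" using assms(7) by (simp add: G_def u_def v_def)
  \<comment> \<open>The coefficients take the form required by the recurrence because
    \<open>z * v = 1\<close> and \<open>z * u = 1 / \<delta>\<close>.\<close>
  have b: "b n = z * (1 - (u + v) * q ^ n)" for n
    using assms(3,4) by (simp add: b_def u_def v_def field_simps)
  have a: "a (Suc n) = - (z\<^sup>2 * u * v * q ^ (2 * n + 1))" for n
    using assms(3,4) by (simp add: a_def u_def v_def power2_eq_square)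
  have den: "(\<lambda>n. cf_den a b n / (z ^ n * qpoch u q n)) \<longlonglongrightarrow> G 0"
  proof -
    \<comment> \<open>The initial values 1 and \<open>b 0 = z * (1 - u - v)\<close> turn the
      constant into the right-hand side of the contiguous relation at \<open>c = u\<close>,
      \<open>w = v\<close>.\<close>
    have "(cf_den a b 1 * G 1 / z - u * v * q / (1 - u * q) * G 2 * cf_den a b 0) =
        (1 - u - v) * G 1 - u * v * q / (1 - u * q) * G 2"
      using assms(4) by (simp add: b diff_diff_eq)
    also have "\<dots> = (1 - u) * G 0"
      using phi11_contiguous[OF assms(2) u, of v]
      by (simp add: G_def power2_eq_square mult.assoc)
    finally show ?thesis
      using recurrence_solution_tendsto[OF assms(2) u assms(4), of "cf_den a b" v] u0
      unfolding G_def by (simp add: a b del: One_nat_def)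
  qed
  \<comment> \<open>Here the initial values are 0 and \<open>a 0 = 1\<close>, so only the
    \<open>G 1\<close> term survives.\<close>
  have num: "(\<lambda>n. cf_num a b n / (z ^ n * qpoch u q n)) \<longlonglongrightarrow> G 1 / z / (1 - u)"
    using recurrence_solution_tendsto[OF assms(2) u assms(4), of "cf_num a b" v]
    by (simp add: a b a_def[THEN fun_cong, of 0] G_def)
  have nz: "z ^ n * qpoch u q n \<noteq> 0" for n
    using assms(4) qpoch_nonzero[of u q n] u by simp
  \<comment> \<open>The normalized denominators tend to \<open>G 0\<close>, which is nonzero; in the
    quotient of the two limits the common normalization cancels.\<close>
  have "\<forall>\<^sub>F n in sequentially. cf_den a b n \<noteq> 0"
    using tendsto_imp_eventually_ne[OF den G0] by eventually_elim auto
  moreover have "(\<lambda>n. cf_num a b n / cf_den a b n) \<longlonglongrightarrow> G 1 / z / (1 - u) / G 0"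
    using tendsto_divide[OF num den G0] nz
    by (simp only: divide_divide_eq_left divide_divide_eq_right times_divide_eq_left
        nonzero_mult_div_cancel_right not_False_eq_True)
  moreover have "G 1 / z / (1 - u) / G 0 = 1 / (z * (1 - 1 / (\<delta> * z))) *
      (phi11 q 0 (q / (z * \<delta>)) (q / z) / phi11 q 0 (1 / (z * \<delta>)) (1 / z))"
    by (simp add: G_def u_def v_def mult.commute)
  ultimately show ?thesis
    unfolding cf_converges_to_def a_def[symmetric] b_def[symmetric] by simp
qed

end
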